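(* Let $P$ be an unguarded GSP process with local state set $S$, and let $\mathcal{M}_\infty=(\mathbb{N}^S,\rightarrow)$ be the associated infinite-state transition system. Let $\preceq$ be the component-wise order on $\mathbb{N}^S$, i.e. $\mathbf{q}\preceq\mathbf{p}$ iff $\mathbf{q}(s)\le\mathbf{p}(s)$ for all $s\in S$. Then $\mathcal{M}_\infty$ equipped with $\preceq$ is a well-structured transition system, and one can effectively compute $Pred$.
   Context: **Unguarded process.** An unguarded (GSP) process is $P=\langle A,S,s_0,T\rangle$ with $S$ a finite set of local states, $s_0\in S$ initial, $T\subseteq S\times A\times S$. The set $A$ of local actions is built from a finite set $\mathcal{A}$ of global actions; each $a\in\mathcal{A}$ has an arity $k\ge1$ and is either a *$k$-sender action* or a *$k$-maximal action*. Each $a$ of arity $k$ contributes local sending actions $a_1!!,\dots,a_k!!$ and a receiving action $a??$. Sends are unique: for each $a_i!!$ there is exactly one transition $s_i\xrightarrow{a_i!!}s_i'$ in $T$. Receives are deterministic and total: for each $s\in S$ there is exactly one state, denoted $M_a(s)$, with $s\xrightarrow{a??}M_a(s)$ in $T$. Also write $M_a$ for the linear map $(M_a\cdot\mathbf{x})(t)=\sum_{s: M_a(s)=t}\mathbf{x}(s)$. Put $\mathbf{v}_a(t)=|\{i: s_i=t\}|$ and $\mathbf{v}'_a(t)=|\{i: s'_i=t\}|$. **Global transitions.** Global states are vectors $\mathbf{q}\in\mathbb{N}^S$ ($\mathbf{q}(s)$ is the number of processes in local state $s$). - If $a$ is a $k$-sender action, it can fire in $\mathbf{q}$ iff $\mathbf{q}(t)\ge\mathbf{v}_a(t)$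 for all $t\in S$, and then $\mathbf{q}\xrightarrow{a}\mathbf{q}'$ with $\mathbf{q}'=M_a\cdot(\mathbf{q}-\mathbf{v}_a)+\mathbf{v}'_a$. - If $a$ is a $k$-maximal action, then $\mathbf{q}\xrightarrow{a}\mathbf{q}'$ iff there is a non-empty $I\subseteq\{1,\dots,k\}$ such that, with $\mathbf{u}(t)=|\{i\in I: s_i=t\}|$ and $\mathbf{u}'(t)=|\{i\in I: s'_i=t\}|$, we have $\mathbf{u}(t)=\min(\mathbf{q}(t),\mathbf{v}_a(t))$ for all $t\in S$ and $\mathbf{q}'=M_a\cdot(\mathbf{q}-\mathbf{u})+\mathbf{u}'$. $\mathcal{M}_\infty$ has state space $\mathbb{N}^S$, and $\mathbf{q}\rightarrow\mathbf{q}'$ iff $\mathbf{q}\xrightarrow{a}\mathbf{q}'$ for some $a\in\mathcal{A}$. (Its initial states are the vectors with $n$ at $s_0$ and $0$ elsewhere, for arbitrary $n\in\mathbb{N}$.) **WSTS.** A well-quasi-order (WQO) on $Q$ is a reflexive transitive relation $\le$ such that every infinite sequence $\mathbf{q}_0,\mathbf{q}_1,\dots$ has indices $i<j$ with $\mathbf{q}_i\le\mathbf{q}_j$. It is compatible with $\rightarrow$ if whenever $\mathbf{q}\le\mathbf{p}$ and $\mathbf{q}\rightarrow\mathbf{q}'$ there is $\mathbf{p}'$ with $\mathbf{q}'\le\mathbf{p}'$ and $\mathbf{p}\rightarrow^*\mathbf{p}'$. A transition system with a compatible WQO is a well-structured transition system (WSTS). **Effective $Pred$.** For $U\subseteq Q$,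 $\uparrow U=\{\mathbf{p}: \exists\mathbf{q}\in U,\ \mathbf{q}\le\mathbf{p}\}$; $U$ is upwards closed if $\uparrow U=U$; a finite basis of an upwards-closed $U$ is a finite $B\subseteq U$ with $\uparrow B=U$. $Pred(U)=\{\mathbf{q}: \exists\mathbf{q}'\in U,\ \mathbf{q}\rightarrow\mathbf{q}'\}$. One can effectively compute $Pred$ if there is an algorithm that, from any finite basis of any upwards-closed set $U\subseteq Q$, computes a finite basis of $Pred(U)$. *)

theory Defs
  imports Main "HOL-Library.Nat_Bijection"
begin

section \<open>Well-structured transition systems\<close>

definition wqo_on :: "'q set \<Rightarrow> ('q \<Rightarrow> 'q \<Rightarrow> bool) \<Rightarrow> bool" where
  "wqo_on Q le \<longleftrightarrow>
     reflp_on Q le \<and> transp_on Q le \<and>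
     (\<forall>f :: nat \<Rightarrow> 'q. (\<forall>i. f i \<in> Q) \<longrightarrow> (\<exists>i j. i < j \<and> le (f i) (f j)))"

definition compatible :: "'q set \<Rightarrow> ('q \<Rightarrow> 'q \<Rightarrow> bool) \<Rightarrow> ('q \<Rightarrow> 'q \<Rightarrow> bool) \<Rightarrow> bool" where
  "compatible Q step le \<longleftrightarrow>
     (\<forall>q \<in> Q. \<forall>p \<in> Q. \<forall>q' \<in> Q. le q p \<and> step q q' \<longrightarrow>
        (\<exists>p' \<in> Q. le q' p' \<and> step\<^sup>*\<^sup>* p p'))"

text \<open>The first conjunct says that \<open>(Q, step)\<close> is a transition system with state space \<open>Q\<close>.\<close>

definition wsts :: "'q set \<Rightarrow> ('q \<Rightarrow> 'q \<Rightarrow> bool) \<Rightarrow> ('q \<Rightarrow> 'q \<Rightarrow> bool) \<Rightarrow> bool" where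
  "wsts Q step le \<longleftrightarrow>
     (\<forall>q q'. step q q' \<longrightarrow> q \<in> Q \<and> q' \<in> Q) \<and> wqo_on Q le \<and> compatible Q step le"

definition upclose :: "'q set \<Rightarrow> ('q \<Rightarrow> 'q \<Rightarrow> bool) \<Rightarrow> 'q set \<Rightarrow> 'q set" where
  "upclose Q le U = {p \<in> Q. \<exists>q \<in> U. le q p}"

definition upclosed :: "'q set \<Rightarrow> ('q \<Rightarrow> 'q \<Rightarrow> bool) \<Rightarrow> 'q set \<Rightarrow> bool" where
  "upclosed Q le U \<longleftrightarrow> U \<subseteq> Q \<and> upclose Q le U = U"

definition finite_basis :: "'q set \<Rightarrow> ('q \<Rightarrow> 'q \<Rightarrow> bool) \<Rightarrow> 'q set \<Rightarrow> 'q set \<Rightarrow> bool" where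
  "finite_basis Q le B U \<longleftrightarrow>
     upclosed Q le U \<and> finite B \<and> B \<subseteq> U \<and> upclose Q le B = U"

definition Pred :: "'q set \<Rightarrow> ('q \<Rightarrow> 'q \<Rightarrow> bool) \<Rightarrow> 'q set \<Rightarrow> 'q set" where
  "Pred Q step U = {q \<in> Q. \<exists>q' \<in> U. step q q'}"


section \<open>Computability\<close>

text \<open>
  \<open>recursive n f\<close>: the restriction of \<open>f\<close> to lists of length \<open>n\<close> is a total recursive function
  of \<open>n\<close> arguments. This is the least class that contains zero, successor and the projections
  and is closed under composition, primitive recursion (on the first argument) and
  minimization of functions that have a zero for every choice of parameters.
  The values of \<open>f\<close> on lists of any other length are irrelevant.
\<close>

inductive recursive :: "nat \<Rightarrow> (nat list \<Rightarrow> nat) \<Rightarrow> bool" where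
  zero: "recursive n (\<lambda>xs. 0)"
| succ: "recursive 1 (\<lambda>xs. Suc (xs ! 0))"
| proj: "i < n \<Longrightarrow> recursive n (\<lambda>xs. xs ! i)"
| comp: "recursive (length gs) f \<Longrightarrow> (\<And>g. g \<in> set gs \<Longrightarrow> recursive n g) \<Longrightarrow>
    recursive n (\<lambda>xs. f (map (\<lambda>g. g xs) gs))"
| prim: "recursive n f \<Longrightarrow> recursive (Suc (Suc n)) g \<Longrightarrow>
    recursive (Suc n) (\<lambda>xs. rec_nat (f (tl xs)) (\<lambda>k r. g (k # r # tl xs)) (hd xs))"
| minim: "recursive (Suc n) f \<Longrightarrow> (\<And>xs. length xs = n \<Longrightarrow> \<exists>k. f (k # xs) = 0) \<Longrightarrow>
    recursive n (\<lambda>xs. LEAST k. f (k # xs) = 0)"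

text \<open>
  The algorithm works on codes of states given by \<open>code\<close>; a finite basis is passed to it and
  returned by it as a list of its elements, in any order and possibly with repetitions.
\<close>

definition effective_Pred ::
  "('q \<Rightarrow> nat) \<Rightarrow> 'q set \<Rightarrow> ('q \<Rightarrow> 'q \<Rightarrow> bool) \<Rightarrow> ('q \<Rightarrow> 'q \<Rightarrow> bool) \<Rightarrow> bool" where
  "effective_Pred code Q step le \<longleftrightarrow>
     (\<exists>f. recursive 1 f \<and>
        (\<forall>U bs. upclosed Q le U \<and> finite_basis Q le (set bs) U \<longrightarrow>
           (\<exists>cs. f [list_encode (map code bs)] = list_encode (map code cs) \<and>
                 finite_basis Q le (set cs) (Pred Q step U))))"


section \<open>Unguarded processes\<close>

datatype action_kind = Sender | Maximal

text \<open>\<open>Send a i\<close> is the local action $a_i!!$, with \<open>i\<close> counted from 1; \<open>Recv a\<close> is $a??$.\<close>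

datatype 'a local_action = Send 'a nat | Recv 'a

record ('a, 's) process =
  actions :: "'a set"
  arity :: "'a \<Rightarrow> nat"
  kind :: "'a \<Rightarrow> action_kind"
  states :: "'s set"
  init :: 's
  transitions :: "('s \<times> 'a local_action \<times> 's) set"

definition local_actions :: "('a, 's) process \<Rightarrow> 'a local_action set" where
  "local_actions P =
     {Send a i | a i. a \<in> actions P \<and> i \<in> {1..arity P a}} \<union> {Recv a | a. a \<in> actions P}"

definition unguarded_process :: "('a, 's) process \<Rightarrow> bool" where
  "unguarded_process P \<longleftrightarrow>
     finite (actions P) \<and> (\<forall>a \<in> actions P. 1 \<le> arity P a) \<and>
     finite (states P) \<and> init P \<in> states P \<and>
     transitions P \<subseteq> states P \<times> local_actions P \<times> states P \<and>
     (\<forall>a \<in> actions P. \<forall>i \<in> {1..arity P a}.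
        \<exists>!(s, s'). (s, Send a i, s') \<in> transitions P) \<and>
     (\<forall>a \<in> actions P. \<forall>s \<in> states P. \<exists>!t. (s, Recv a, t) \<in> transitions P)"

definition src :: "('a, 's) process \<Rightarrow> 'a \<Rightarrow> nat \<Rightarrow> 's" where
  "src P a i = (THE s. \<exists>s'. (s, Send a i, s') \<in> transitions P)"

definition tgt :: "('a, 's) process \<Rightarrow> 'a \<Rightarrow> nat \<Rightarrow> 's" where
  "tgt P a i = (THE s'. \<exists>s. (s, Send a i, s') \<in> transitions P)"

definition recv :: "('a, 's) process \<Rightarrow> 'a \<Rightarrow> 's \<Rightarrow> 's" where
  "recv P a s = (THE t. (s, Recv a, t) \<in> transitions P)"

definition recv_map :: "('a, 's) process \<Rightarrow> 'a \<Rightarrow> ('s \<Rightarrow> nat) \<Rightarrow> 's \<Rightarrow> nat" where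
  "recv_map P a x t = (\<Sum>s | s \<in> states P \<and> recv P a s = t. x s)"

text \<open>
  For a set \<open>I\<close> of sender indices, \<open>senders P a I\<close> and \<open>sent P a I\<close> count the sources and the
  targets of the corresponding sending transitions; for \<open>I = {1..arity P a}\<close> these are the
  vectors $v_a$ and $v'_a$.
\<close>

definition senders :: "('a, 's) process \<Rightarrow> 'a \<Rightarrow> nat set \<Rightarrow> 's \<Rightarrow> nat" where
  "senders P a I t = card {i \<in> I. src P a i = t}"

definition sent :: "('a, 's) process \<Rightarrow> 'a \<Rightarrow> nat set \<Rightarrow> 's \<Rightarrow> nat" where
  "sent P a I t = card {i \<in> I. tgt P a i = t}"


section \<open>The global transition system\<close>

text \<open>
  Vectors indexed by the local states are functions that vanish outside \<open>states P\<close>.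
\<close>

definition configs :: "('a, 's) process \<Rightarrow> ('s \<Rightarrow> nat) set" where
  "configs P = {q. \<forall>s. s \<notin> states P \<longrightarrow> q s = 0}"

definition config_le :: "('a, 's) process \<Rightarrow> ('s \<Rightarrow> nat) \<Rightarrow> ('s \<Rightarrow> nat) \<Rightarrow> bool" where
  "config_le P q p \<longleftrightarrow> (\<forall>s \<in> states P. q s \<le> p s)"

definition fire :: "('a, 's) process \<Rightarrow> 'a \<Rightarrow> nat set \<Rightarrow> ('s \<Rightarrow> nat) \<Rightarrow> 's \<Rightarrow> nat" where
  "fire P a I q = (\<lambda>t. recv_map P a (\<lambda>s. q s - senders P a I s) t + sent P a I t)"

text \<open>
  The subtraction in \<open>fire\<close> is never truncated below: the vector of the participating
  senders is bounded by \<open>q\<close> in both cases.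
\<close>

definition action_step ::
  "('a, 's) process \<Rightarrow> 'a \<Rightarrow> ('s \<Rightarrow> nat) \<Rightarrow> ('s \<Rightarrow> nat) \<Rightarrow> bool" where
  "action_step P a q q' \<longleftrightarrow>
     (case kind P a of
        Sender \<Rightarrow>
          (\<forall>t \<in> states P. senders P a {1..arity P a} t \<le> q t) \<and>
          q' = fire P a {1..arity P a} q
      | Maximal \<Rightarrow>
          (\<exists>I. I \<noteq> {} \<and> I \<subseteq> {1..arity P a} \<and>
             (\<forall>t \<in> states P. senders P a I t = min (q t) (senders P a {1..arity P a} t)) \<and>
             q' = fire P a I q))"

definition step :: "('a, 's) process \<Rightarrow> ('s \<Rightarrow> nat) \<Rightarrow> ('s \<Rightarrow> nat) \<Rightarrow> bool" where
  "step P q q' \<longleftrightarrow> q \<in> configs P \<and> (\<exists>a \<in> actions P. action_step P a q q')"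

text \<open>The code of a vector, relative to an enumeration \<open>ss\<close> of the local states.\<close>

definition config_code :: "'s list \<Rightarrow> ('s \<Rightarrow> nat) \<Rightarrow> nat" where
  "config_code ss q = list_encode (map q ss)"

end

theory Submission
  imports Defs
begin

text \<open>
  In both kinds of action the participating senders at \<open>t\<close> number \<open>min (q t) (v t)\<close>, so passing to a
  larger state can only enlarge the set of senders and the vector of remaining receivers; hence a
  step is matched by a single step, and Dickson's lemma gives the well-structured system.

  For \<open>Pred\<close>, let \<open>m\<close> bound the entries of a finite basis and let \<open>k\<close> bound the arities.
  Truncating all entries of a predecessor at \<open>m + k\<close> yields a predecessor again, because a
  truncated entry still delivers at least \<open>m\<close> receivers to its image. So the predecessors with
  entries at most \<open>m + k\<close> form a finite basis. Codes are monotone in the entries, which makes it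
  enough to run through all codes up to that of the constant vector \<open>m + k\<close> and to keep those that
  pass a decidable test.
\<close>

section \<open>Closure properties of recursive functions\<close>

text \<open>Agreement is asked only on lists of length \<open>n\<close>, so a function may be
  written in any convenient form, whatever it does on other lists.\<close>

definition computable :: "nat \<Rightarrow> (nat list \<Rightarrow> nat) \<Rightarrow> bool" where
  "computable n f \<longleftrightarrow> (\<exists>g. recursive n g \<and> (\<forall>xs. length xs = n \<longrightarrow> f xs = g xs))"

lemma computable_cong:
  assumes "computable n g" and "\<And>xs. length xs = n \<Longrightarrow> f xs = g xs"
  shows "computable n f"
  using assms unfolding computable_def by metis

lemma computable_proj: "i < n \<Longrightarrow> computable n (\<lambda>xs. xs ! i)"
  unfolding computable_def using recursive.proj by blast

lemma computable_compose:
  assumes f: "computable (length gs) f" and gs: "\<And>g. g \<in> set gs \<Longrightarrow> computable n g"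
  shows "computable n (\<lambda>xs. f (map (\<lambda>g. g xs) gs))"
proof -
  obtain f' where f': "recursive (length gs) f'" "\<And>xs. length xs = length gs \<Longrightarrow> f xs = f' xs"
    using f unfolding computable_def by blast
  obtain G where G: "\<And>g. g \<in> set gs \<Longrightarrow> recursive n (G g) \<and> (\<forall>xs. length xs = n \<longrightarrow> g xs = G g xs)"
    using gs unfolding computable_def by metis
  have "recursive n (\<lambda>xs. f' (map (\<lambda>g. g xs) (map G gs)))"
    by (rule recursive.comp) (use f' G in auto)
  moreover have "f (map (\<lambda>g. g xs) gs) = f' (map (\<lambda>g. g xs) (map G gs))" if "length xs = n" for xs
  proof -
    have "map (\<lambda>g. g xs) gs = map (\<lambda>g. g xs) (map G gs)"
      using G that by simp
    then show ?thesis
      using f'(2)[of "map (\<lambda>g. g xs) gs"] by (simp only: length_map)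
  qed
  ultimately show ?thesis
    unfolding computable_def by blast
qed

lemma computable_compose1:
  assumes "computable 1 (\<lambda>ys. h (ys ! 0))" "computable n f"
  shows "computable n (\<lambda>xs. h (f xs))"
  using computable_compose[of "[f]" "\<lambda>ys. h (ys ! 0)" n] assms by simp

lemma computable_compose2:
  assumes "computable 2 (\<lambda>ys. h (ys ! 0) (ys ! 1))" "computable n f" "computable n g"
  shows "computable n (\<lambda>xs. h (f xs) (g xs))"
  using computable_compose[of "[f, g]" "\<lambda>ys. h (ys ! 0) (ys ! 1)" n] assms
  by (auto simp: numeral_2_eq_2)

lemma computable_const: "computable n (\<lambda>_. c)"
proof (induction c)
  case 0
  show ?case
    unfolding computable_def using recursive.zero by blast
next
  case (Suc c)
  have "computable 1 (\<lambda>ys. Suc (ys ! 0))"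
    unfolding computable_def using recursive.succ by blast
  from computable_compose1[OF this Suc] show ?case .
qed

lemma computable_Suc: "computable n f \<Longrightarrow> computable n (\<lambda>xs. Suc (f xs))"
  using computable_compose1[of Suc n f] recursive.succ unfolding computable_def by blast

text \<open>Turns recursion on the head of the list into recursion up to a computed bound
  \<open>k xs\<close> with all of \<open>xs\<close> as parameters. Step functions read the counter
  at index 0, the accumulator at 1 and the parameters from 2 on.\<close>

lemma computable_rec_nat:
  assumes k: "computable n k" and f: "computable n f" and g: "computable (Suc (Suc n)) g"
  shows "computable n (\<lambda>xs. rec_nat (f xs) (\<lambda>i r. g (i # r # xs)) (k xs))"
proof -
  obtain f' where f': "recursive n f'" "\<And>xs. length xs = n \<Longrightarrow> f xs = f' xs"
    using f unfolding computable_def by blast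
  obtain g' where g': "recursive (Suc (Suc n)) g'"
    "\<And>xs. length xs = Suc (Suc n) \<Longrightarrow> g xs = g' xs"
    using g unfolding computable_def by blast
  let ?R = "\<lambda>xs. rec_nat (f (tl xs)) (\<lambda>i r. g (i # r # tl xs)) (hd xs)"
  have "computable (Suc n) ?R"
    unfolding computable_def
  proof (intro exI conjI allI impI)
    show "recursive (Suc n) (\<lambda>xs. rec_nat (f' (tl xs)) (\<lambda>i r. g' (i # r # tl xs)) (hd xs))"
      by (rule recursive.prim[OF f'(1) g'(1)])
    fix xs :: "nat list"
    assume "length xs = Suc n"
    then have "f (tl xs) = f' (tl xs)" "\<And>i r. g (i # r # tl xs) = g' (i # r # tl xs)"
      by (simp_all add: f'(2) g'(2))
    then show "?R xs = rec_nat (f' (tl xs)) (\<lambda>i r. g' (i # r # tl xs)) (hd xs)"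
      by simp
  qed
  \<comment> \<open>Composing with \<open>k\<close> and all \<open>n\<close> projections supplies
    the bound as head and \<open>xs\<close> itself as tail.\<close>
  then have *: "computable n (\<lambda>xs. ?R (map (\<lambda>g. g xs) (k # map (\<lambda>i xs. xs ! i) [0..<n])))"
    by (intro computable_compose) (auto simp: k intro: computable_proj)
  have "map (\<lambda>i. xs ! i) [0..<n] = xs" if "length xs = n" for xs :: "nat list"
    using map_nth[of xs] that by simp
  then show ?thesis
    by (intro computable_cong[OF *]) (simp add: comp_def)
qed

lemma computable_LEAST:
  assumes f: "computable (Suc n) f" and ex: "\<And>xs. length xs = n \<Longrightarrow> \<exists>k. f (k # xs) = 0"
  shows "computable n (\<lambda>xs. LEAST k. f (k # xs) = 0)"
proof -
  obtain f' where f': "recursive (Suc n) f'" "\<And>xs. length xs = Suc n \<Longrightarrow> f xs = f' xs"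
    using f unfolding computable_def by blast
  have "recursive n (\<lambda>xs. LEAST k. f' (k # xs) = 0)"
    by (rule recursive.minim[OF f'(1)]) (use ex f'(2) in force)
  then show ?thesis
    unfolding computable_def using f'(2) by force
qed

text \<open>Lets a function of counter and parameters be used inside a recursion step, which also
  receives the accumulator.\<close>

lemma computable_drop_second:
  assumes "computable (Suc n) g"
  shows "computable (Suc (Suc n)) (\<lambda>ys. g (hd ys # tl (tl ys)))"
proof -
  let ?gs = "map (\<lambda>i (ys :: nat list). ys ! i) (0 # [2..<Suc (Suc n)])"
  have *: "computable (Suc (Suc n)) (\<lambda>ys. g (map (\<lambda>h. h ys) ?gs))"
  proof (rule computable_compose)
    have "length ?gs = Suc n"
      by (simp del: upt_Suc)
    with assms show "computable (length ?gs) g"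
      by (simp only:)
  qed (auto intro: computable_proj)
  show ?thesis
  proof (rule computable_cong[OF *])
    fix ys :: "nat list"
    assume "length ys = Suc (Suc n)"
    then obtain a b zs where ys: "ys = a # b # zs" "length zs = n"
      by (metis length_Suc_conv)
    then have "hd ys # tl (tl ys) = map (\<lambda>h. h ys) ?gs"
      by (intro nth_equalityI) (auto simp: nth_Cons' simp del: upt_Suc)
    then show "g (hd ys # tl (tl ys)) = g (map (\<lambda>h. h ys) ?gs)"
      by simp
  qed
qed

subsection \<open>Arithmetic\<close>

lemma computable_add:
  assumes "computable n f" "computable n g"
  shows "computable n (\<lambda>xs. f xs + g xs)"
proof -
  have "computable n (\<lambda>xs. rec_nat (f xs) (\<lambda>i r. Suc ((i # r # xs) ! 1)) (g xs))"
    by (intro computable_rec_nat computable_Suc computable_proj assms) simp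
  moreover have "rec_nat a (\<lambda>i. Suc) b = a + b" for a b
    by (induction b) auto
  ultimately show ?thesis
    by simp
qed

lemma computable_mult:
  assumes "computable n f" "computable n g"
  shows "computable n (\<lambda>xs. f xs * g xs)"
\<comment> \<open>It suffices to multiply two projections; the second factor is then a parameter
  that the recursion step reads at index 3.\<close>
proof (rule computable_compose2[OF _ assms])
  have "computable 2 (\<lambda>xs. rec_nat 0 (\<lambda>i r. (i # r # xs) ! 1 + (i # r # xs) ! 3) (xs ! 0))"
    by (rule computable_rec_nat) (intro computable_add computable_proj computable_const; simp)+
  moreover have "rec_nat 0 (\<lambda>i r. r + b) a = a * b" for a b :: nat
    by (induction a) auto
  ultimately show "computable 2 (\<lambda>xs. xs ! 0 * xs ! 1)"
    by (simp add: numeral_3_eq_3)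
qed

text \<open>Subtraction iterates the predecessor, which is the recursion that forgets its
  accumulator and returns its counter.\<close>

lemma computable_diff:
  assumes "computable n f" "computable n g"
  shows "computable n (\<lambda>xs. f xs - g xs)"
proof (rule computable_compose2[OF _ assms])
  have "computable 1 (\<lambda>xs. rec_nat 0 (\<lambda>i r. (i # r # xs) ! 0) (xs ! 0))"
    by (intro computable_rec_nat computable_const computable_proj) simp_all
  moreover have "rec_nat 0 (\<lambda>i r. i) a = a - 1" for a :: nat
    by (cases a) auto
  ultimately have pred: "computable 1 (\<lambda>xs. xs ! 0 - 1)"
    by simp
  have "computable 2 (\<lambda>xs. rec_nat (xs ! 0) (\<lambda>i r. (i # r # xs) ! 1 - 1) (xs ! 1))"
    by (intro computable_rec_nat computable_compose1[OF pred] computable_proj) simp_all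
  moreover have "rec_nat a (\<lambda>i r. r - 1) b = a - b" for a b :: nat
    by (induction b) auto
  ultimately show "computable 2 (\<lambda>xs. xs ! 0 - xs ! 1)"
    by simp
qed

lemma computable_min:
  assumes "computable n f" "computable n g"
  shows "computable n (\<lambda>xs. min (f xs) (g xs))"
proof (rule computable_cong)
  \<comment> \<open>With truncated subtraction, \<open>a - (a - b)\<close> is the minimum of
    \<open>a\<close> and \<open>b\<close>.\<close>
  show "computable n (\<lambda>xs. f xs - (f xs - g xs))"
    by (intro computable_diff assms)
qed auto

lemma computable_sum:
  assumes "finite A" "\<And>a. a \<in> A \<Longrightarrow> computable n (f a)"
  shows "computable n (\<lambda>xs. \<Sum>a\<in>A. f a xs)"
  using assms by (induction A rule: finite_induct) (auto intro: computable_const computable_add)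

lemma computable_prod:
  assumes "finite A" "\<And>a. a \<in> A \<Longrightarrow> computable n (f a)"
  shows "computable n (\<lambda>xs. \<Prod>a\<in>A. f a xs)"
  using assms by (induction A rule: finite_induct) (auto intro: computable_const computable_mult)

lemma computable_funpow:
  assumes h: "computable 1 (\<lambda>ys. h (ys ! 0))" and "computable n f" "computable n g"
  shows "computable n (\<lambda>xs. (h ^^ f xs) (g xs))"
proof -
  have "computable n (\<lambda>xs. rec_nat (g xs) (\<lambda>i r. h ((i # r # xs) ! 1)) (f xs))"
    by (intro computable_rec_nat computable_compose1[OF h] computable_proj assms) simp
  moreover have "rec_nat a (\<lambda>i. h) k = (h ^^ k) a" for a k
    by (induction k) auto
  ultimately show ?thesis
    by simp
qed

subsection \<open>Decidable predicates\<close>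

text \<open>With zero as truth, truncated subtraction decides \<open>\<le>\<close>, a sum decides
  conjunction and a product decides disjunction.\<close>

definition decidable :: "nat \<Rightarrow> (nat list \<Rightarrow> bool) \<Rightarrow> bool" where
  "decidable n p \<longleftrightarrow> (\<exists>f. computable n f \<and> (\<forall>xs. length xs = n \<longrightarrow> p xs \<longleftrightarrow> f xs = 0))"

lemma decidableI:
  "computable n f \<Longrightarrow> (\<And>xs. length xs = n \<Longrightarrow> p xs \<longleftrightarrow> f xs = 0) \<Longrightarrow> decidable n p"
  unfolding decidable_def by blast

lemma decidable_const: "decidable n (\<lambda>_. c)"
  by (rule decidableI[OF computable_const[of n "of_bool (\<not> c)"]]) simp

lemma decidable_le:
  assumes "computable n f" "computable n g"
  shows "decidable n (\<lambda>xs. f xs \<le> g xs)"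
  by (rule decidableI[OF computable_diff[OF assms]]) simp

lemma decidable_eq:
  assumes "computable n f" "computable n g"
  shows "decidable n (\<lambda>xs. f xs = g xs)"
  by (rule decidableI[OF computable_add[OF computable_diff[OF assms] computable_diff[OF assms(2,1)]]])
    auto

lemma decidable_conj:
  assumes "decidable n p" "decidable n q"
  shows "decidable n (\<lambda>xs. p xs \<and> q xs)"
proof -
  obtain f g where fg: "computable n f" "computable n g"
    "\<And>xs. length xs = n \<Longrightarrow> (p xs \<longleftrightarrow> f xs = 0) \<and> (q xs \<longleftrightarrow> g xs = 0)"
    using assms unfolding decidable_def by blast
  show ?thesis
    by (rule decidableI[OF computable_add[OF fg(1,2)]]) (simp add: fg(3))
qed

lemma decidable_not:
  assumes "decidable n p"
  shows "decidable n (\<lambda>xs. \<not> p xs)"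
proof -
  obtain f where f: "computable n f" "\<And>xs. length xs = n \<Longrightarrow> p xs \<longleftrightarrow> f xs = 0"
    using assms unfolding decidable_def by blast
  show ?thesis
    by (rule decidableI[OF computable_diff[OF computable_const[of n 1] f(1)]]) (auto simp: f(2))
qed

lemma decidable_Bex:
  assumes "finite A" "\<And>a. a \<in> A \<Longrightarrow> decidable n (p a)"
  shows "decidable n (\<lambda>xs. \<exists>a\<in>A. p a xs)"
proof -
  obtain f where f: "\<And>a. a \<in> A \<Longrightarrow> computable n (f a)"
    "\<And>a xs. a \<in> A \<Longrightarrow> length xs = n \<Longrightarrow> p a xs \<longleftrightarrow> f a xs = 0"
    using assms(2) unfolding decidable_def by metis
  show ?thesis
    by (rule decidableI[OF computable_prod[OF assms(1) f(1)]]) (auto simp: f(2) assms(1))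
qed

lemma decidable_Ball:
  assumes "finite A" "\<And>a. a \<in> A \<Longrightarrow> decidable n (p a)"
  shows "decidable n (\<lambda>xs. \<forall>a\<in>A. p a xs)"
  using decidable_not[OF decidable_Bex[OF assms(1) decidable_not[OF assms(2)]]] by simp

text \<open>The range depends on the input, so the product of the truth values is computed by
  recursion; it starts from 1, which stands for falsity on the empty range.\<close>

lemma decidable_bounded_ex:
  assumes k: "computable n k" and p: "decidable (Suc n) p"
  shows "decidable n (\<lambda>xs. \<exists>i < k xs. p (i # xs))"
proof -
  obtain f where f: "computable (Suc n) f" "\<And>xs. length xs = Suc n \<Longrightarrow> p xs \<longleftrightarrow> f xs = 0"
    using p unfolding decidable_def by blast
  let ?g = "\<lambda>ys. ys ! 1 * f (hd ys # tl (tl ys))"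
  have "computable (Suc (Suc n)) ?g"
    by (intro computable_mult computable_proj computable_drop_second f(1)) simp
  then have "computable n (\<lambda>xs. rec_nat 1 (\<lambda>i r. ?g (i # r # xs)) (k xs))"
    by (rule computable_rec_nat[OF k computable_const])
  then show ?thesis
  proof (rule decidableI)
    fix xs :: "nat list"
    assume "length xs = n"
    then have p_iff: "p (i # xs) \<longleftrightarrow> f (i # xs) = 0" for i
      by (simp add: f(2))
    have "(\<exists>i<m. p (i # xs)) \<longleftrightarrow> rec_nat 1 (\<lambda>i r. ?g (i # r # xs)) m = 0" for m
      by (induction m) (auto simp: p_iff less_Suc_eq)
    then show "(\<exists>i<k xs. p (i # xs)) \<longleftrightarrow> rec_nat 1 (\<lambda>i r. ?g (i # r # xs)) (k xs) = 0" .
  qed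
qed

lemma computable_if:
  assumes p: "decidable n p" and "computable n f" "computable n g"
  shows "computable n (\<lambda>xs. if p xs then f xs else g xs)"
proof -
  obtain h where h: "computable n h" "\<And>xs. length xs = n \<Longrightarrow> p xs \<longleftrightarrow> h xs = 0"
    using p unfolding decidable_def by blast
  \<comment> \<open>\<open>1 - h xs\<close> is 1 if \<open>p xs\<close> holds and 0 otherwise, so it
    selects one of the two summands.\<close>
  have "computable n (\<lambda>xs. f xs * (1 - h xs) + g xs * (1 - (1 - h xs)))"
    by (intro computable_add computable_mult computable_diff computable_const h assms)
  then show ?thesis
    by (rule computable_cong) (auto simp: h(2))
qed

subsection \<open>Pairs and lists\<close>

lemma computable_triangle:
  assumes "computable n f"
  shows "computable n (\<lambda>xs. triangle (f xs))"
proof -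
  have "computable n (\<lambda>xs. rec_nat 0 (\<lambda>i r. (i # r # xs) ! 1 + Suc ((i # r # xs) ! 0)) (f xs))"
    by (rule computable_rec_nat)
      (intro computable_add computable_Suc computable_proj computable_const assms; simp)+
  moreover have "rec_nat 0 (\<lambda>i r. r + Suc i) k = triangle k" for k
    by (induction k) auto
  ultimately show ?thesis
    by simp
qed

lemma computable_prod_encode:
  assumes "computable n f" "computable n g"
  shows "computable n (\<lambda>xs. prod_encode (f xs, g xs))"
  unfolding prod_encode_def by (simp, intro computable_add computable_triangle assms)

lemma triangle_mono: "m \<le> n \<Longrightarrow> triangle m \<le> triangle n"
  unfolding triangle_def by (intro div_le_mono mult_le_mono) auto

lemma le_triangle: "n \<le> triangle n"
  by (induction n) auto

text \<open>\<open>prod_encode (a, b)\<close> is \<open>triangle (a + b) + a\<close>, so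
  \<open>z\<close> sits at offset \<open>a\<close> on diagonal \<open>a + b\<close>. That diagonal
  is the first whose successor starts beyond \<open>z\<close>; the truncated subtraction expresses
  \<open>z < triangle (Suc s)\<close>.\<close>

lemma prod_decode_Least:
  fixes z :: nat
  defines "s \<equiv> (LEAST s. Suc z - triangle (Suc s) = 0)"
  shows "fst (prod_decode z) = z - triangle s" "snd (prod_decode z) = s - (z - triangle s)"
proof -
  obtain a b where ab: "prod_decode z = (a, b)"
    by (cases "prod_decode z")
  then have z: "z = triangle (a + b) + a"
    using prod_decode_inverse[of z] by (simp add: prod_encode_def)
  have "s = a + b"
    unfolding s_def
  proof (rule Least_equality)
    show "Suc z - triangle (Suc (a + b)) = 0"
      by (simp add: z)
    fix k
    assume "Suc z - triangle (Suc k) = 0"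
    then have "triangle (a + b) < triangle (Suc k)"
      using z by linarith
    then show "a + b \<le> k"
      using triangle_mono[of "Suc k" "a + b"] by linarith
  qed
  then show "fst (prod_decode z) = z - triangle s" "snd (prod_decode z) = s - (z - triangle s)"
    using z ab by simp_all
qed

lemma computable_prod_decode:
  assumes "computable n f"
  shows "computable n (\<lambda>xs. fst (prod_decode (f xs)))"
    and "computable n (\<lambda>xs. snd (prod_decode (f xs)))"
proof -
  have "computable 1 (\<lambda>xs. LEAST k. Suc ((k # xs) ! 1) - triangle (Suc ((k # xs) ! 0)) = 0)"
  proof (rule computable_LEAST)
    show "computable (Suc 1) (\<lambda>xs. Suc (xs ! 1) - triangle (Suc (xs ! 0)))"
      by (intro computable_diff computable_Suc computable_triangle computable_proj) simp_all
    fix xs :: "nat list"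
    \<comment> \<open>The argument itself solves the inequality, so the minimization is
      total.\<close>
    have "Suc (xs ! 0) - triangle (Suc (xs ! 0)) = 0"
      using le_triangle[of "Suc (xs ! 0)"] by simp
    then show "\<exists>k. Suc ((k # xs) ! 1) - triangle (Suc ((k # xs) ! 0)) = 0"
      by (intro exI[of _ "xs ! 0"]) simp
  qed
  then have "computable 1 (\<lambda>xs. LEAST k. Suc (xs ! 0) - triangle (Suc k) = 0)"
    by simp
  note * = computable_compose1[OF this]
  show "computable n (\<lambda>xs. fst (prod_decode (f xs)))"
    and "computable n (\<lambda>xs. snd (prod_decode (f xs)))"
    unfolding prod_decode_Least by (intro computable_diff computable_triangle * assms)+
qed

text \<open>The code of a nonempty list is the successor of the pair of its head and the code of its
  tail; \<open>c - 1\<close> removes the successor.\<close>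

definition hd_code :: "nat \<Rightarrow> nat" where
  "hd_code c = fst (prod_decode (c - 1))"

definition tl_code :: "nat \<Rightarrow> nat" where
  "tl_code c = snd (prod_decode (c - 1))"

lemma hd_code_Cons [simp]: "hd_code (list_encode (x # xs)) = x"
  and tl_code_Cons [simp]: "tl_code (list_encode (x # xs)) = list_encode xs"
  by (simp_all add: hd_code_def tl_code_def)

lemma computable_hd_code: "computable n f \<Longrightarrow> computable n (\<lambda>xs. hd_code (f xs))"
  and computable_tl_code: "computable n f \<Longrightarrow> computable n (\<lambda>xs. tl_code (f xs))"
  unfolding hd_code_def tl_code_def
  by (intro computable_prod_decode computable_diff computable_const; assumption)+

lemma computable_list_encode:
  assumes "\<And>f. f \<in> set fs \<Longrightarrow> computable n f"
  shows "computable n (\<lambda>xs. list_encode (map (\<lambda>f. f xs) fs))"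
  using assms
proof (induction fs)
  case (Cons f fs)
  then have "computable n (\<lambda>xs. Suc (prod_encode (f xs, list_encode (map (\<lambda>f. f xs) fs))))"
    by (intro computable_Suc computable_prod_encode) simp_all
  then show ?case
    by simp
qed (simp add: computable_const)

lemma funpow_tl_code: "i \<le> length xs \<Longrightarrow> (tl_code ^^ i) (list_encode xs) = list_encode (drop i xs)"
proof (induction i arbitrary: xs)
  case (Suc i)
  then obtain y ys where "xs = y # ys" "i \<le> length ys"
    by (cases xs) auto
  with Suc.IH[of ys] show ?case
    by (simp add: funpow_Suc_right del: funpow.simps list_encode.simps)
qed simp

text \<open>\<open>0\<close> codes the empty list and is a fixed point of \<open>tl_code\<close>.
  Hence being nonzero after \<open>i\<close> steps tells whether position \<open>i\<close> exists,
  without a length function on codes.\<close>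

lemma funpow_tl_code_beyond:
  assumes "length xs \<le> i"
  shows "(tl_code ^^ i) (list_encode xs) = 0"
proof -
  have "tl_code 0 = 0"
    using prod_encode_inverse[of "(0, 0)"] by (simp add: tl_code_def prod_encode_def)
  then have "(tl_code ^^ k) 0 = 0" for k
    by (induction k) auto
  moreover have "(tl_code ^^ (i - length xs + length xs)) (list_encode xs) = (tl_code ^^ (i - length xs)) 0"
    unfolding funpow_add by (simp add: funpow_tl_code)
  ultimately show ?thesis
    using assms by simp
qed

section \<open>Size and monotonicity of list codes\<close>

lemma length_le_list_encode: "length xs \<le> list_encode xs"
proof (induction xs)
  case (Cons x xs)
  then show ?case
    using le_prod_encode_2[of "list_encode xs" x] by simp
qed simp

lemma member_le_list_encode: "x \<in> set xs \<Longrightarrow> x \<le> list_encode xs"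
proof (induction xs)
  case (Cons y xs)
  then show ?case
    using le_prod_encode_1[of y "list_encode xs"] le_prod_encode_2[of "list_encode xs" y] by auto
qed simp

lemma prod_encode_mono:
  assumes "a \<le> a'" "b \<le> b'"
  shows "prod_encode (a, b) \<le> prod_encode (a', b')"
  using assms triangle_mono[of "a + b" "a' + b'"] by (simp add: prod_encode_def)

lemma list_encode_mono: "list_all2 (\<le>) xs ys \<Longrightarrow> list_encode xs \<le> list_encode ys"
  by (induction rule: list_all2_induct) (auto intro: prod_encode_mono)


section \<open>Dickson's lemma\<close>

text \<open>Every tail of \<open>f\<close> attains its minimum, so beyond any position there is one
  whose value bounds all later values from below; an increasing sequence of such positions is
  chosen.\<close>

lemma mono_subsequence_nat:
  fixes f :: "nat \<Rightarrow> nat"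
  shows "\<exists>\<phi> :: nat \<Rightarrow> nat. strict_mono \<phi> \<and> mono (\<lambda>i. f (\<phi> i))"
proof -
  have min: "\<exists>k\<ge>m. \<forall>j\<ge>k. f k \<le> f j" for m
  proof -
    obtain k where "m \<le> k" "\<And>j. m \<le> j \<Longrightarrow> f k \<le> f j"
      using ex_has_least_nat[of "\<lambda>k. m \<le> k" m f] by auto
    then show ?thesis
      by (intro exI[of _ k]) auto
  qed
  have "\<exists>\<phi> :: nat \<Rightarrow> nat. \<forall>n. (\<forall>j\<ge>\<phi> n. f (\<phi> n) \<le> f j) \<and> \<phi> n < \<phi> (Suc n)"
  proof (rule dependent_nat_choice)
    show "\<exists>k. \<forall>j\<ge>k. f k \<le> f j"
      using min by blast
    show "\<exists>l. (\<forall>j\<ge>l. f l \<le> f j) \<and> k < l" for k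
      using min[of "Suc k"] by (auto simp: Suc_le_eq)
  qed
  then obtain \<phi> where \<phi>: "\<And>n j. \<phi> n \<le> j \<Longrightarrow> f (\<phi> n) \<le> f j" "\<And>n. \<phi> n < \<phi> (Suc n)"
    by blast
  from \<phi>(2) have "strict_mono \<phi>"
    by (simp add: strict_mono_Suc_iff)
  with \<phi>(1) show ?thesis
    by (intro exI[of _ \<phi>]) (auto intro!: monoI simp: strict_mono_less_eq)
qed

text \<open>One coordinate is treated at a time: a further subsequence keeps the earlier coordinates
  monotone.\<close>

lemma mono_subsequence_fun:
  fixes f :: "nat \<Rightarrow> 's \<Rightarrow> nat"
  assumes "finite S"
  shows "\<exists>\<phi> :: nat \<Rightarrow> nat. strict_mono \<phi> \<and> (\<forall>s\<in>S. mono (\<lambda>i. f (\<phi> i) s))"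
  using assms
proof (induction S rule: finite_induct)
  case empty
  show ?case
    by (auto intro!: exI[of _ "\<lambda>i. i"] strict_monoI)
next
  case (insert s S)
  then obtain \<phi> :: "nat \<Rightarrow> nat" where \<phi>: "strict_mono \<phi>" "\<And>t. t \<in> S \<Longrightarrow> mono (\<lambda>i. f (\<phi> i) t)"
    by blast
  obtain \<psi> :: "nat \<Rightarrow> nat" where \<psi>: "strict_mono \<psi>" "mono (\<lambda>i. f (\<phi> (\<psi> i)) s)"
    using mono_subsequence_nat[of "\<lambda>i. f (\<phi> i) s"] by blast
  have "mono (\<lambda>i. f (\<phi> (\<psi> i)) t)" if "t \<in> S" for t
    using \<phi>(2)[OF that] \<psi>(1) by (auto simp: mono_def strict_mono_less_eq)
  with \<phi>(1) \<psi> show ?case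
    by (intro exI[of _ "\<phi> \<circ> \<psi>"]) (auto simp: strict_mono_def)
qed

lemma wqo_on_config_le:
  assumes "finite (states P)"
  shows "wqo_on (configs P) (config_le P)"
  unfolding wqo_on_def
proof (intro conjI allI impI)
  show "reflp_on (configs P) (config_le P)"
    by (auto intro: reflp_onI simp: config_le_def)
  show "transp_on (configs P) (config_le P)"
    by (rule transp_onI) (meson config_le_def order_trans)
  fix f :: "nat \<Rightarrow> 'a \<Rightarrow> nat"
  obtain \<phi> :: "nat \<Rightarrow> nat" where "strict_mono \<phi>" "\<And>s. s \<in> states P \<Longrightarrow> mono (\<lambda>i. f (\<phi> i) s)"
    using mono_subsequence_fun[OF assms, of f] by blast
  \<comment> \<open>The first two members of the subsequence already form a good pair.\<close>
  then have "\<phi> 0 < \<phi> 1" "config_le P (f (\<phi> 0)) (f (\<phi> 1))"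
    by (auto simp: config_le_def strict_mono_less dest: monoD)
  then show "\<exists>i j. i < j \<and> config_le P (f i) (f j)"
    by blast
qed

section \<open>Monotonicity of the global transitions\<close>

text \<open>Exposes the set \<open>I\<close> of participating senders for both kinds of action, so
  that most later arguments treat them uniformly; a sender action admits only the full set.\<close>

definition enabled :: "('a, 's) process \<Rightarrow> 'a \<Rightarrow> nat set \<Rightarrow> ('s \<Rightarrow> nat) \<Rightarrow> bool" where
  "enabled P a I q \<longleftrightarrow>
     (case kind P a of
        Sender \<Rightarrow> I = {1..arity P a} \<and> (\<forall>t \<in> states P. senders P a {1..arity P a} t \<le> q t)
      | Maximal \<Rightarrow> I \<noteq> {} \<and>
          (\<forall>t \<in> states P. senders P a I t = min (q t) (senders P a {1..arity P a} t)))"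

lemma step_iff:
  "step P q q' \<longleftrightarrow> q \<in> configs P \<and>
     (\<exists>a \<in> actions P. \<exists>I \<in> Pow {1..arity P a}. enabled P a I q \<and> q' = fire P a I q)"
proof -
  have "action_step P a q q' \<longleftrightarrow>
      (\<exists>I \<in> Pow {1..arity P a}. enabled P a I q \<and> q' = fire P a I q)" for a
    unfolding action_step_def enabled_def by (cases "kind P a"; simp; blast)
  then show ?thesis
    by (simp add: step_def)
qed

lemma enabled_senders:
  "enabled P a I q \<Longrightarrow> t \<in> states P \<Longrightarrow>
     senders P a I t = min (q t) (senders P a {1..arity P a} t)"
  unfolding enabled_def by (auto split: action_kind.splits)

section \<open>Transitions stay inside the local states\<close>

lemma src_tgt_in_states:
  assumes "unguarded_process P" "a \<in> actions P" "i \<in> {1..arity P a}"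
  shows "src P a i \<in> states P" "tgt P a i \<in> states P"
proof -
  have "\<exists>!(s, s'). (s, Send a i, s') \<in> transitions P"
    using assms unfolding unguarded_process_def by blast
  then obtain s s' where s: "(s, Send a i, s') \<in> transitions P"
    and unique: "\<And>u u'. (u, Send a i, u') \<in> transitions P \<Longrightarrow> u = s \<and> u' = s'"
    by blast
  have "src P a i = s" "tgt P a i = s'"
    unfolding src_def tgt_def using s unique by blast+
  then show "src P a i \<in> states P" "tgt P a i \<in> states P"
    using s assms(1) unfolding unguarded_process_def by auto
qed

lemma recv_in_states:
  assumes "unguarded_process P" "a \<in> actions P" "s \<in> states P"
  shows "recv P a s \<in> states P"
proof -
  have "\<exists>!t. (s, Recv a, t) \<in> transitions P"
    using assms unfolding unguarded_process_def by blast
  then have "(s, Recv a, recv P a s) \<in> transitions P"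
    unfolding recv_def by (rule theI')
  then show ?thesis
    using assms(1) unfolding unguarded_process_def by auto
qed

lemma fire_in_configs:
  assumes "unguarded_process P" "a \<in> actions P" "I \<subseteq> {1..arity P a}"
  shows "fire P a I q \<in> configs P"
proof -
  have "fire P a I q t = 0" if "t \<notin> states P" for t
  proof -
    have "{s \<in> states P. recv P a s = t} = {}" "{i \<in> I. tgt P a i = t} = {}"
      using that recv_in_states[OF assms(1,2)] src_tgt_in_states(2)[OF assms(1,2)] assms(3) by auto
    then show ?thesis
      by (simp only: fire_def recv_map_def sent_def sum.empty card.empty add_0)
  qed
  then show ?thesis
    by (simp add: configs_def)
qed

text \<open>For a maximal action the set is enlarged separately at each source state, up to the size
  demanded by \<open>p\<close>. The pieces for different states cannot overlap, because an index has
  only one source.\<close>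

lemma enabled_mono:
  assumes P: "unguarded_process P" "a \<in> actions P" and I: "I \<subseteq> {1..arity P a}"
    and en: "enabled P a I q" and le: "config_le P q p"
  shows "\<exists>J. I \<subseteq> J \<and> J \<subseteq> {1..arity P a} \<and> enabled P a J p"
proof (cases "kind P a")
  case Sender
  with en le I show ?thesis
    unfolding enabled_def config_le_def by (intro exI[of _ I]) (auto intro: order_trans)
next
  case Maximal
  let ?part = "\<lambda>I t. {i \<in> I. src P a i = t}"
  \<comment> \<open>The minimum grows from \<open>q\<close> to \<open>p\<close> and never exceeds
    the number of all senders at \<open>t\<close>, so a set of the demanded size fits in
    between.\<close>
  have ex: "\<exists>B. ?part I t \<subseteq> B \<and> B \<subseteq> ?part {1..arity P a} t \<and>
      card B = min (p t) (senders P a {1..arity P a} t)" if "t \<in> states P" for t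
  proof (rule exists_subset_between)
    have "q t \<le> p t"
      using le that by (simp add: config_le_def)
    then show "card (?part I t) \<le> min (p t) (senders P a {1..arity P a} t)"
      using enabled_senders[OF en that] by (simp add: senders_def)
  qed (use I in \<open>auto simp: senders_def\<close>)
  have "\<forall>t\<in>states P. \<exists>B. ?part I t \<subseteq> B \<and> B \<subseteq> ?part {1..arity P a} t \<and>
      card B = min (p t) (senders P a {1..arity P a} t)"
    using ex by (rule ballI)
  from bchoice[OF this] obtain B where B: "\<And>t. t \<in> states P \<Longrightarrow> ?part I t \<subseteq> B t"
    "\<And>t. t \<in> states P \<Longrightarrow> B t \<subseteq> ?part {1..arity P a} t"
    "\<And>t. t \<in> states P \<Longrightarrow> card (B t) = min (p t) (senders P a {1..arity P a} t)"
    by blast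
  define J where "J = (\<Union>t\<in>states P. B t)"
  \<comment> \<open>No index of \<open>I\<close> is lost, since every source is a local
    state.\<close>
  have "I \<subseteq> J"
    unfolding J_def using B(1) src_tgt_in_states(1)[OF P] I by blast
  moreover have "J \<subseteq> {1..arity P a}"
    unfolding J_def using B(2) by blast
  moreover have "?part J t = B t" if "t \<in> states P" for t
    unfolding J_def using B(2) that by blast
  moreover have "I \<noteq> {}"
    using en Maximal by (simp add: enabled_def)
  ultimately show ?thesis
    using Maximal B(3) by (intro exI[of _ J]) (auto simp: enabled_def senders_def)
qed

text \<open>The receivers left at \<open>s\<close> number \<open>q s\<close> minus its minimum with
  the full sender count. This equals the truncated difference of the two, which grows with
  \<open>q\<close>; a larger sender set only adds targets.\<close>

lemma fire_mono:
  assumes le: "config_le P q p" and IJ: "I \<subseteq> J" "J \<subseteq> {1..arity P a}"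
    and en: "enabled P a I q" "enabled P a J p"
  shows "fire P a I q t \<le> fire P a J p t"
proof -
  have "recv_map P a (\<lambda>s. q s - senders P a I s) t \<le> recv_map P a (\<lambda>s. p s - senders P a J s) t"
    unfolding recv_map_def
  proof (rule sum_mono)
    fix s
    assume "s \<in> {s \<in> states P. recv P a s = t}"
    with le en show "q s - senders P a I s \<le> p s - senders P a J s"
      by (auto simp: enabled_senders config_le_def min_def)
  qed
  moreover have "sent P a I t \<le> sent P a J t"
    unfolding sent_def using IJ by (intro card_mono) (auto intro: finite_subset)
  ultimately show ?thesis
    by (simp add: fire_def)
qed

theorem wsts_unguarded:
  assumes P: "unguarded_process P"
  shows "wsts (configs P) (step P) (config_le P)"
  unfolding wsts_def
proof (intro conjI allI impI)
  show "q \<in> configs P" "q' \<in> configs P" if "step P q q'" for q q'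
    using that fire_in_configs[OF P] by (auto simp: step_iff)
  show "wqo_on (configs P) (config_le P)"
    using P by (intro wqo_on_config_le) (simp add: unguarded_process_def)
  show "compatible (configs P) (step P) (config_le P)"
    unfolding compatible_def
  proof (intro ballI impI)
    fix q p q'
    assume qp: "p \<in> configs P" "config_le P q p \<and> step P q q'"
    then obtain a I where a: "a \<in> actions P" "I \<subseteq> {1..arity P a}" "enabled P a I q" "q' = fire P a I q"
      by (auto simp: step_iff)
    obtain J where J: "I \<subseteq> J" "J \<subseteq> {1..arity P a}" "enabled P a J p"
      using enabled_mono[OF P a(1-3) conjunct1[OF qp(2)]] by blast
    show "\<exists>p'\<in>configs P. config_le P q' p' \<and> (step P)\<^sup>*\<^sup>* p p'"
    proof (intro bexI conjI)
      show "config_le P q' (fire P a J p)"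
        using fire_mono[OF _ J(1,2) a(3) J(3)] qp a(4) by (simp add: config_le_def)
      show "(step P)\<^sup>*\<^sup>* p (fire P a J p)"
        using qp(1) a(1) J by (intro r_into_rtranclp) (auto simp: step_iff)
    qed (rule fire_in_configs[OF P a(1) J(2)])
  qed
qed

section \<open>Predecessors\<close>

text \<open>For a configuration \<open>q\<close>, this is membership in \<open>Pred\<close> of the
  upward closure of \<open>b\<close>. For an unguarded process all quantifiers range over fixed
  finite sets, which makes it decidable.\<close>

definition can_cover :: "('a, 's) process \<Rightarrow> ('s \<Rightarrow> nat) \<Rightarrow> ('s \<Rightarrow> nat) \<Rightarrow> bool" where
  "can_cover P q b \<longleftrightarrow> (\<exists>a \<in> actions P. \<exists>I \<in> Pow {1..arity P a}.
     enabled P a I q \<and> (\<forall>t \<in> states P. b t \<le> fire P a I q t))"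

text \<open>The enlarged sender set from \<open>enabled_mono\<close> fires to a larger state. This
  is what makes \<open>Pred\<close> of an upward closed set upward closed.\<close>

lemma can_cover_mono:
  assumes P: "unguarded_process P" and "can_cover P q b" and le: "config_le P q p"
  shows "can_cover P p b"
proof -
  obtain a I where a: "a \<in> actions P" "I \<subseteq> {1..arity P a}" "enabled P a I q"
    and b: "\<And>t. t \<in> states P \<Longrightarrow> b t \<le> fire P a I q t"
    using assms(2) by (auto simp: can_cover_def)
  obtain J where "I \<subseteq> J" "J \<subseteq> {1..arity P a}" "enabled P a J p"
    using enabled_mono[OF P a le] by blast
  with a b show ?thesis
    unfolding can_cover_def by (blast intro: order_trans fire_mono[OF le])
qed

text \<open>Since \<open>U\<close> is generated by \<open>B\<close>, landing in \<open>U\<close>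
  means dominating some \<open>b\<close>, and the choice of \<open>b\<close> can be moved in front
  of that of the action.\<close>

lemma Pred_eq_can_cover:
  assumes P: "unguarded_process P" and U: "finite_basis (configs P) (config_le P) B U"
  shows "Pred (configs P) (step P) U = {q \<in> configs P. \<exists>b\<in>B. can_cover P q b}"
proof -
  have "q' \<in> U \<longleftrightarrow> (\<exists>b\<in>B. \<forall>t\<in>states P. b t \<le> q' t)" if "q' \<in> configs P" for q'
    using U that by (auto simp: finite_basis_def upclose_def config_le_def)
  then have fire: "fire P a I q \<in> U \<longleftrightarrow> (\<exists>b\<in>B. \<forall>t\<in>states P. b t \<le> fire P a I q t)"
    if "a \<in> actions P" "I \<in> Pow {1..arity P a}" for a I q
    using fire_in_configs[OF P] that by simp
  have "Pred (configs P) (step P) U = {q \<in> configs P. \<exists>a\<in>actions P. \<exists>I\<in>Pow {1..arity P a}.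
      enabled P a I q \<and> fire P a I q \<in> U}"
    unfolding Pred_def step_iff by blast
  also have "\<dots> = {q \<in> configs P. \<exists>b\<in>B. can_cover P q b}"
  proof (intro Collect_cong conj_cong refl)
    fix q
    have swap: "(\<exists>a\<in>A. \<exists>I\<in>F a. E a I \<and> (\<exists>b\<in>B. R a I b))
        \<longleftrightarrow> (\<exists>b\<in>B. \<exists>a\<in>A. \<exists>I\<in>F a. E a I \<and> R a I b)"
      for A :: "'a set" and F :: "'a \<Rightarrow> nat set set" and E R
      by blast
    have "(\<exists>a\<in>actions P. \<exists>I\<in>Pow {1..arity P a}. enabled P a I q \<and> fire P a I q \<in> U)
        \<longleftrightarrow> (\<exists>a\<in>actions P. \<exists>I\<in>Pow {1..arity P a}. enabled P a I q \<and>
              (\<exists>b\<in>B. \<forall>t\<in>states P. b t \<le> fire P a I q t))"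
      by (intro bex_cong conj_cong refl fire)
    then show "(\<exists>a\<in>actions P. \<exists>I\<in>Pow {1..arity P a}. enabled P a I q \<and> fire P a I q \<in> U)
        \<longleftrightarrow> (\<exists>b\<in>B. can_cover P q b)"
      unfolding can_cover_def swap .
  qed
  finally show ?thesis .
qed

text \<open>A state truncated to \<open>m + k\<close> keeps at least \<open>m\<close> processes after the \<open>k\<close> senders leave,
  which is enough to cover \<open>b\<close> at the state to which it is mapped.\<close>

lemma can_cover_truncate:
  assumes P: "unguarded_process P" and cov: "can_cover P p b"
    and k: "\<And>a. a \<in> actions P \<Longrightarrow> arity P a \<le> k" and m: "\<And>t. t \<in> states P \<Longrightarrow> b t \<le> m"
  shows "can_cover P (\<lambda>s. min (p s) (m + k)) b"
proof -
  let ?q = "\<lambda>s. min (p s) (m + k)"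
  obtain a I where a: "a \<in> actions P" "I \<subseteq> {1..arity P a}" and en: "enabled P a I p"
    and b: "\<And>t. t \<in> states P \<Longrightarrow> b t \<le> fire P a I p t"
    using cov by (auto simp: can_cover_def)
  have fin: "finite (states P)"
    using P by (simp add: unguarded_process_def)
  have v: "senders P a J t \<le> k" if "J \<subseteq> {1..arity P a}" for J t
  proof -
    have "senders P a J t \<le> card {1..arity P a}"
      unfolding senders_def using that by (intro card_mono) auto
    with k[OF a(1)] show ?thesis
      by simp
  qed
  \<comment> \<open>The threshold is at least every sender count, so truncation changes no minimum
    with such a count and \<open>I\<close> stays enabled.\<close>
  have va: "senders P a {1..arity P a} t \<le> m + k" for t
    using v[of "{1..arity P a}" t] by simp
  then have "min (?q t) (senders P a {1..arity P a} t) = min (p t) (senders P a {1..arity P a} t)" for t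
    by (simp add: min.assoc min.absorb2)
  with en va have "enabled P a I ?q"
    unfolding enabled_def by (simp split: action_kind.splits)
  moreover have "b t \<le> fire P a I ?q t" if t: "t \<in> states P" for t
  \<comment> \<open>If some state mapped to \<open>t\<close> is truncated, it alone supplies
    \<open>m\<close> receivers; otherwise the sum at \<open>t\<close> is unchanged.\<close>
  proof (cases "\<exists>s\<in>states P. recv P a s = t \<and> m + k < p s")
    case True
    then obtain s where s: "s \<in> {s \<in> states P. recv P a s = t}" "m + k < p s"
      by blast
    have "b t \<le> ?q s - senders P a I s"
      using m[OF t] v[OF a(2), of s] s(2) by simp
    also have "\<dots> \<le> recv_map P a (\<lambda>s. ?q s - senders P a I s) t"
      unfolding recv_map_def by (rule member_le_sum[OF s(1)]) (auto simp: fin)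
    finally show ?thesis
      by (simp add: fire_def)
  next
    case False
    then have "recv_map P a (\<lambda>s. ?q s - senders P a I s) t
        = recv_map P a (\<lambda>s. p s - senders P a I s) t"
      unfolding recv_map_def by (intro sum.cong) auto
    with b[OF t] show ?thesis
      by (simp add: fire_def)
  qed
  ultimately show ?thesis
    using a unfolding can_cover_def by blast
qed

section \<open>The algorithm\<close>

text \<open>Every number decodes to some vector, so candidates need no check for being a proper
  code; several numbers may give the same vector.\<close>

primrec config_of :: "'s list \<Rightarrow> nat \<Rightarrow> 's \<Rightarrow> nat" where
  "config_of [] c = (\<lambda>_. 0)"
| "config_of (s # ss) c = (config_of ss (tl_code c))(s := hd_code c)"

lemma config_of_config_code: "config_of ss (config_code ss q) s = (if s \<in> set ss then q s else 0)"
  by (induction ss) (auto simp: config_code_def simp del: list_encode.simps)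

lemma config_of_in_configs: "set ss = states P \<Longrightarrow> config_of ss c \<in> configs P"
proof -
  have "s \<notin> set ss \<Longrightarrow> config_of ss c s = 0" for s
    by (induction ss arbitrary: c) auto
  then show "set ss = states P \<Longrightarrow> config_of ss c \<in> configs P"
    by (auto simp: configs_def)
qed

text \<open>For fixed \<open>s\<close> the position in \<open>ss\<close> is fixed as well, so the
  entry is a fixed composition of \<open>tl_code\<close> and \<open>hd_code\<close>, or 0 if
  \<open>s\<close> does not occur.\<close>

lemma computable_config_of: "computable n f \<Longrightarrow> computable n (\<lambda>xs. config_of ss (f xs) s)"
proof (induction ss arbitrary: f)
  case (Cons t ss)
  show ?case
    using Cons.IH[OF computable_tl_code[OF Cons.prems]] computable_hd_code[OF Cons.prems]
    by (cases "s = t") simp_all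
qed (simp add: computable_const)

text \<open>\<open>P\<close> is fixed, so sender counts, targets and receive maps are constants;
  only the vector entries depend on the input.\<close>

lemma decidable_can_cover:
  assumes P: "unguarded_process P" and fg: "computable n f" "computable n g"
  shows "decidable n (\<lambda>xs. can_cover P (config_of ss (f xs)) (config_of ss (g xs)))"
proof -
  have fin: "finite (actions P)" "finite (states P)"
    using P by (simp_all add: unguarded_process_def)
  have "decidable n (\<lambda>xs. enabled P a I (config_of ss (f xs)))" for a I
    unfolding enabled_def
    by (cases "kind P a"; simp only: action_kind.case;
        intro decidable_conj decidable_const decidable_Ball fin decidable_le decidable_eq
          computable_min computable_const computable_config_of fg)
  moreover have "computable n (\<lambda>xs. fire P a I (config_of ss (f xs)) t)" for a I t
    unfolding fire_def recv_map_def
    by (intro computable_add computable_sum computable_diff computable_const computable_config_of fg)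
      (simp add: fin)
  ultimately show ?thesis
    unfolding can_cover_def
    by (intro decidable_Bex decidable_conj decidable_Ball decidable_le computable_config_of fin fg) simp_all
qed

text \<open>Here \<open>x\<close> codes the basis and \<open>n\<close> a candidate. Positions in the
  basis are searched below \<open>x\<close>, and the nonzero test discards those past its
  end.\<close>

definition covers_member :: "('a, 's) process \<Rightarrow> 's list \<Rightarrow> nat \<Rightarrow> nat \<Rightarrow> bool" where
  "covers_member P ss x n \<longleftrightarrow> (\<exists>i<x. (tl_code ^^ i) x \<noteq> 0 \<and>
     can_cover P (config_of ss n) (config_of ss (hd_code ((tl_code ^^ i) x))))"

lemma covers_member_iff:
  assumes "set ss = states P" "set bs \<subseteq> configs P"
  shows "covers_member P ss (list_encode (map (config_code ss) bs)) n
    \<longleftrightarrow> (\<exists>b\<in>set bs. can_cover P (config_of ss n) b)"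
proof -
  let ?x = "list_encode (map (config_code ss) bs)"
  have tl: "(tl_code ^^ i) ?x = list_encode (config_code ss (bs ! i) # map (config_code ss) (drop (Suc i) bs))"
    if "i < length bs" for i
    using that funpow_tl_code[of i "map (config_code ss) bs"]
    by (simp add: drop_map Cons_nth_drop_Suc[symmetric] del: list_encode.simps)
  have "(tl_code ^^ i) ?x \<noteq> 0 \<longleftrightarrow> i < length bs" for i
    using tl[of i] funpow_tl_code_beyond[of "map (config_code ss) bs" i] by (cases "i < length bs") auto
  moreover have "config_of ss (hd_code ((tl_code ^^ i) ?x)) = bs ! i" if "i < length bs" for i
  proof
    fix s
    have "bs ! i \<in> configs P"
      using that assms(2) by auto
    then show "config_of ss (hd_code ((tl_code ^^ i) ?x)) s = (bs ! i) s"
      using that assms(1)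
      by (auto simp: tl config_of_config_code configs_def simp del: list_encode.simps)
  qed
  \<comment> \<open>The search bound \<open>?x\<close> reaches every position of the list.\<close>
  moreover have "length bs \<le> ?x"
    using length_le_list_encode[of "map (config_code ss) bs"] by simp
  ultimately have "i < ?x \<and> (tl_code ^^ i) ?x \<noteq> 0 \<and>
      can_cover P (config_of ss n) (config_of ss (hd_code ((tl_code ^^ i) ?x)))
    \<longleftrightarrow> i < length bs \<and> can_cover P (config_of ss n) (bs ! i)" for i
    by (cases "i < length bs") simp_all
  then have "covers_member P ss ?x n \<longleftrightarrow> (\<exists>i<length bs. can_cover P (config_of ss n) (bs ! i))"
    by (simp only: covers_member_def)
  also have "\<dots> \<longleftrightarrow> (\<exists>b\<in>set bs. can_cover P (config_of ss n) b)"
    unfolding set_conv_nth by blast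
  finally show ?thesis .
qed

text \<open>The layout is that of a recursion step: the candidate is the counter at index 0, the
  accumulator is at 1 and the basis code at 2.\<close>

lemma decidable_covers_member:
  assumes P: "unguarded_process P"
  shows "decidable 3 (\<lambda>ys. covers_member P ss (ys ! 2) (ys ! 0))"
proof -
  have tl1: "computable 1 (\<lambda>ys. tl_code (ys ! 0))"
    by (intro computable_tl_code computable_proj) simp
  \<comment> \<open>The bound variable is put in front, which shifts the candidate to index 1 and
    the basis code to index 3.\<close>
  have "decidable 3 (\<lambda>ys. \<exists>i<ys ! 2. (tl_code ^^ ((i # ys) ! 0)) ((i # ys) ! 3) \<noteq> 0 \<and>
      can_cover P (config_of ss ((i # ys) ! 1))
        (config_of ss (hd_code ((tl_code ^^ ((i # ys) ! 0)) ((i # ys) ! 3)))))"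
  proof (rule decidable_bounded_ex[where p = "\<lambda>zs. (tl_code ^^ (zs ! 0)) (zs ! 3) \<noteq> 0 \<and>
      can_cover P (config_of ss (zs ! 1)) (config_of ss (hd_code ((tl_code ^^ (zs ! 0)) (zs ! 3))))"])
    show "computable 3 (\<lambda>ys. ys ! 2)"
      by (intro computable_proj) simp
    have *: "computable (Suc 3) (\<lambda>zs. (tl_code ^^ (zs ! 0)) (zs ! 3))"
      by (intro computable_funpow tl1 computable_proj) simp_all
    show "decidable (Suc 3) (\<lambda>zs. (tl_code ^^ (zs ! 0)) (zs ! 3) \<noteq> 0 \<and>
      can_cover P (config_of ss (zs ! 1)) (config_of ss (hd_code ((tl_code ^^ (zs ! 0)) (zs ! 3)))))"
      by (intro decidable_conj decidable_not decidable_eq decidable_can_cover P * computable_hd_code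
          computable_const computable_proj) simp
  qed
  then show ?thesis
    by (simp add: covers_member_def)
qed

text \<open>The successor of a pair is list construction on codes. The candidate is decoded and
  encoded again because \<open>n\<close> need not be the code of a vector; it may code a list of the
  wrong length.\<close>

definition collect_step :: "('a, 's) process \<Rightarrow> 's list \<Rightarrow> nat \<Rightarrow> nat \<Rightarrow> nat \<Rightarrow> nat" where
  "collect_step P ss x n r =
     (if covers_member P ss x n then Suc (prod_encode (config_code ss (config_of ss n), r)) else r)"

text \<open>Every element of a list is at most the code of the list, so the code \<open>x\<close> of a basis
  bounds the entries of all its elements and \<open>x + k\<close> is a valid threshold for truncation.\<close>

definition pred_code :: "('a, 's) process \<Rightarrow> 's list \<Rightarrow> nat \<Rightarrow> nat \<Rightarrow> nat" where
  "pred_code P ss k x =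
     rec_nat 0 (collect_step P ss x) (Suc (list_encode (replicate (length ss) (x + k))))"

section \<open>Computability and correctness of the enumeration\<close>

lemma computable_config_code_config_of:
  assumes "computable n f"
  shows "computable n (\<lambda>xs. config_code ss (config_of ss (f xs)))"
proof -
  have "computable n (\<lambda>xs. list_encode (map (\<lambda>f. f xs) (map (\<lambda>s xs. config_of ss (f xs) s) ss)))"
    by (rule computable_list_encode) (auto intro: computable_config_of assms)
  then show ?thesis
    by (simp add: config_code_def comp_def)
qed

lemma computable_pred_code:
  assumes P: "unguarded_process P"
  shows "computable 1 (\<lambda>xs. pred_code P ss k (xs ! 0))"
proof -
  \<comment> \<open>The constant vector is written as a list of equal functions, the form that
    \<open>computable_list_encode\<close> accepts.\<close>
  have bound: "computable 1 (\<lambda>xs. Suc (list_encode (map (\<lambda>f. f xs) (replicate (length ss) (\<lambda>xs. xs ! 0 + k)))))"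
    by (intro computable_Suc computable_list_encode)
      (auto intro!: computable_add computable_proj computable_const)
  have "computable 3 (\<lambda>ys. collect_step P ss (ys ! 2) (ys ! 0) (ys ! 1))"
    unfolding collect_step_def
    by (intro computable_if decidable_covers_member P computable_Suc computable_prod_encode
        computable_config_code_config_of computable_proj) simp_all
  then have "computable (Suc (Suc 1)) (\<lambda>ys. collect_step P ss (ys ! 2) (ys ! 0) (ys ! 1))"
    by (simp add: numeral_3_eq_3)
  from computable_rec_nat[OF bound computable_const[of 1 0] this] show ?thesis
    by (simp add: pred_code_def map_replicate)
qed

text \<open>Accepted candidates are prepended, hence the reversal; the start value 0 codes the empty
  list.\<close>

lemma rec_nat_collect_step:
  "rec_nat 0 (collect_step P ss x) m =
     list_encode (map (config_code ss) (map (config_of ss) (rev (filter (covers_member P ss x) [0..<m]))))"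
  by (induction m) (auto simp: collect_step_def)

lemma finite_basis_pred_code:
  assumes P: "unguarded_process P" and ss: "set ss = states P"
    and k: "\<And>a. a \<in> actions P \<Longrightarrow> arity P a \<le> k"
    and bs: "finite_basis (configs P) (config_le P) (set bs) U"
  shows "\<exists>cs. pred_code P ss k (list_encode (map (config_code ss) bs)) = list_encode (map (config_code ss) cs) \<and>
    finite_basis (configs P) (config_le P) (set cs) (Pred (configs P) (step P) U)"
proof -
  let ?Q = "configs P" and ?le = "config_le P"
  define x where "x = list_encode (map (config_code ss) bs)"
  define M where "M = list_encode (replicate (length ss) (x + k))"
  \<comment> \<open>\<open>M\<close> codes the constant vector \<open>x + k\<close>, which may
    itself be a truncated predecessor, so the range must include \<open>M\<close>.\<close>
  define cs where "cs = map (config_of ss) (rev (filter (covers_member P ss x) [0..<Suc M]))"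
  have bsQ: "set bs \<subseteq> ?Q"
    using bs by (auto simp: finite_basis_def upclosed_def)
  have Pred: "Pred ?Q (step P) U = {q \<in> ?Q. \<exists>b\<in>set bs. can_cover P q b}"
    by (rule Pred_eq_can_cover[OF P bs])
  have cs: "set cs = {config_of ss n | n. n \<le> M \<and> (\<exists>b\<in>set bs. can_cover P (config_of ss n) b)}"
    unfolding cs_def x_def
    by (auto simp: covers_member_iff[OF ss bsQ] less_Suc_eq_le simp del: upt_Suc)
  have cs_sub: "set cs \<subseteq> Pred ?Q (step P) U"
    unfolding cs Pred using config_of_in_configs[OF ss] by auto
  have closed: "p \<in> Pred ?Q (step P) U"
    if "p \<in> ?Q" "q \<in> Pred ?Q (step P) U" "?le q p" for p q
    using that can_cover_mono[OF P _ that(3)] by (auto simp: Pred)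
  have basis: "\<exists>q\<in>set cs. ?le q p" if p: "p \<in> Pred ?Q (step P) U" for p
  proof -
    obtain b where b: "b \<in> set bs" "can_cover P p b" "p \<in> ?Q"
      using p by (auto simp: Pred)
    \<comment> \<open>This is the truncation with \<open>m\<close> taken as \<open>x\<close>: an
      entry of \<open>b\<close> is at most the code of \<open>b\<close>, which is at most the code
      \<open>x\<close> of the basis.\<close>
    define q where "q = (\<lambda>s. min (p s) (x + k))"
    have "b t \<le> x" if "t \<in> states P" for t
    proof -
      have "b t \<le> config_code ss b"
        unfolding config_code_def by (rule member_le_list_encode) (use that ss in auto)
      also have "\<dots> \<le> x"
        unfolding x_def by (rule member_le_list_encode) (use b(1) in auto)
      finally show ?thesis .
    qed
    then have cov: "can_cover P q b"
      unfolding q_def by (intro can_cover_truncate[OF P b(2) k])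
    \<comment> \<open>Like \<open>p\<close>, the vector \<open>q\<close> vanishes outside the local
      states, so decoding its code gives \<open>q\<close> back and testing that number tests
      \<open>q\<close>.\<close>
    have q: "config_of ss (config_code ss q) = q"
      using b(3) ss by (auto simp: config_of_config_code configs_def q_def)
    have "config_code ss q \<le> M"
      unfolding config_code_def M_def
      by (rule list_encode_mono) (auto simp: list_all2_conv_all_nth q_def)
    with cov q b(1) have "q \<in> set cs"
      unfolding cs by (metis (mono_tags, lifting) mem_Collect_eq)
    moreover have "?le q p"
      by (simp add: config_le_def q_def)
    ultimately show ?thesis
      by blast
  qed
  have sub: "Pred ?Q (step P) U \<subseteq> ?Q"
    unfolding Pred by blast
  have refl: "?le q q" for q
    by (simp add: config_le_def)
  have "upclose ?Q ?le (Pred ?Q (step P) U) = Pred ?Q (step P) U"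
    unfolding upclose_def using sub closed refl by blast
  moreover have "upclose ?Q ?le (set cs) = Pred ?Q (step P) U"
    unfolding upclose_def using sub cs_sub closed basis by blast
  ultimately have "finite_basis ?Q ?le (set cs) (Pred ?Q (step P) U)"
    using sub cs_sub by (simp add: finite_basis_def upclosed_def)
  moreover have "pred_code P ss k x = list_encode (map (config_code ss) cs)"
    unfolding pred_code_def cs_def M_def by (rule rec_nat_collect_step)
  ultimately show ?thesis
    unfolding x_def by blast
qed

theorem theorem2:
  fixes P :: "('a, 's) process"
  assumes "unguarded_process P"
  shows "wsts (configs P) (step P) (config_le P) \<and>
    (\<forall>ss. distinct ss \<and> set ss = states P \<longrightarrow>
       effective_Pred (config_code ss) (configs P) (step P) (config_le P))"
proof (intro conjI allI impI)
  show "wsts (configs P) (step P) (config_le P)"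
    by (rule wsts_unguarded[OF assms])
  fix ss
  assume ss: "distinct ss \<and> set ss = states P"
  \<comment> \<open>Any common bound on the arities will do; a sum avoids the maximum of a possibly
    empty set.\<close>
  define k where "k = (\<Sum>a\<in>actions P. arity P a)"
  have k: "arity P a \<le> k" if "a \<in> actions P" for a
    unfolding k_def by (rule member_le_sum[OF that]) (use assms in \<open>auto simp: unguarded_process_def\<close>)
  \<comment> \<open>The recursive function agrees with \<open>pred_code\<close> on lists of length
    1, the only inputs on which \<open>effective_Pred\<close> evaluates it.\<close>
  obtain f where f: "recursive 1 f" "\<And>xs. length xs = 1 \<Longrightarrow> pred_code P ss k (xs ! 0) = f xs"
    using computable_pred_code[OF assms, of ss k] unfolding computable_def by blast
  have fx: "f [x] = pred_code P ss k x" for x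
    using f(2)[of "[x]"] by simp
  show "effective_Pred (config_code ss) (configs P) (step P) (config_le P)"
    unfolding effective_Pred_def
  proof (intro exI[of _ f] conjI allI impI)
    show "recursive 1 f"
      by (rule f(1))
    show "\<exists>cs. f [list_encode (map (config_code ss) bs)] = list_encode (map (config_code ss) cs) \<and>
        finite_basis (configs P) (config_le P) (set cs) (Pred (configs P) (step P) U)"
      if "upclosed (configs P) (config_le P) U \<and> finite_basis (configs P) (config_le P) (set bs) U"
      for U bs
      unfolding fx by (rule finite_basis_pred_code[OF assms conjunct2[OF ss] k conjunct2[OF that]])
  qed
qed

end
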